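(* Let $A=(a_{ij})$ be an $m\times n$ real matrix, let $b=(\beta_1,\ldots,\beta_n)$ be a real $n$-vector and let $s>0$ be a real number. Let $$B=sI+\tfrac12 A^TA,$$ which is an $n\times n$ positive definite matrix. Let $q=e^{-s}$ and define $F_{A,b,s}:\mathbb{R}^m\to\mathbb{R}_+$ by $$F_{A,b,s}(t)=\prod_{j=1}^n\prod_{k=1}^\infty\left(1+2q^{2k-1}\cos\Bigl(\beta_j+\sum_{i=1}^m a_{ij}\tau_i\Bigr)+q^{4k-2}\right),\qquad t=(\tau_1,\ldots,\tau_m).$$ Then the following hold. (1) We have $$(2\pi)^{-m/2}\prod_{k=1}^\infty\left(1-q^{2k}\right)^n\int_{\mathbb{R}^m}F_{A,b,s}(t)\,e^{-\|t\|^2/2}\,dt=\sum_{x\in\mathbb{Z}^n}\exp\left\{-\langle Bx,x\rangle+\mathbf{i}\langle b,x\rangle\right\}.$$ (2) Suppose that $$\|A^TA\|_{\mathrm{op}}\sum_{k=1}^\infty\frac{q^{2k-1}}{(1-q^{2k-1})^2}\ \le\ \frac12 .$$ Then for every integer $K>0$ the function $G=G_{A,b,s,K}:\mathbb{R}^m\to\mathbb{R}_+$ defined by $$G(t)=e^{-\|t\|^2/2}\prod_{j=1}^n\prod_{k=1}^K\left(1+2q^{2k-1}\cos\Bigl(\beta_j+\sum_{i=1}^m a_{ij}\tau_i\Bigr)+q^{4k-2}\right),\qquad t=(\tau_1,\ldots,\tau_m),$$ is log-concave. In particular, the function $t\mapsto F_{A,b,s}(t)\,e^{-\|t\|^2/2}$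 is log-concave.
   Context: $\langle\cdot,\cdot\rangle$ and $\|\cdot\|$ are the standard scalar product and Euclidean norm; $I$ is the $n\times n$ identity matrix; $\mathbf{i}^2=-1$; $\|\cdot\|_{\mathrm{op}}$ is the operator norm of a matrix, that is, its largest singular value. $\mathbb{R}_+$ denotes the non-negative reals. A function $G:\mathbb{R}^m\to\mathbb{R}_+$ is log-concave if $G(\alpha x+(1-\alpha)y)\ge G^{\alpha}(x)G^{1-\alpha}(y)$ for all $x,y\in\mathbb{R}^m$ and all $0\le\alpha\le1$. *)

theory Defs
  imports "HOL-Analysis.Analysis"
begin

text \<open>
  The value 0 powr 0 = 0 (rather than 1) is harmless here: for \<alpha> = 0 or \<alpha> = 1 the inequality holds
  for every nonnegative G under either convention.
\<close>

definition log_concave :: "('a::real_vector \<Rightarrow> real) \<Rightarrow> bool" where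
  "log_concave G \<longleftrightarrow>
     (\<forall>x. 0 \<le> G x) \<and>
     (\<forall>x y \<alpha>. 0 \<le> \<alpha> \<and> \<alpha> \<le> 1 \<longrightarrow>
        G (\<alpha> *\<^sub>R x + (1 - \<alpha>) *\<^sub>R y) \<ge> G x powr \<alpha> * G y powr (1 - \<alpha>))"

definition positive_definite :: "real^'n^'n \<Rightarrow> bool" where
  "positive_definite M \<longleftrightarrow> transpose M = M \<and> (\<forall>x. x \<noteq> 0 \<longrightarrow> (M *v x) \<bullet> x > 0)"

definition integer_lattice :: "(real^'n) set" where
  "integer_lattice = {x. \<forall>j. x $ j \<in> \<int>}"

definition B_mat :: "real^'n^'m \<Rightarrow> real \<Rightarrow> real^'n^'n" where
  "B_mat A s = s *\<^sub>R mat 1 + (1/2) *\<^sub>R (transpose A ** A)"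

text \<open>The truncated subtractions are only meaningful for k \<ge> 1, the range used below.\<close>

definition theta_factor :: "real \<Rightarrow> nat \<Rightarrow> real \<Rightarrow> real" where
  "theta_factor q k \<theta> = 1 + 2 * q ^ (2 * k - 1) * cos \<theta> + q ^ (4 * k - 2)"

definition phase :: "real^'n^'m \<Rightarrow> real^'n \<Rightarrow> 'n \<Rightarrow> real^'m \<Rightarrow> real" where
  "phase A b j t = b $ j + (\<Sum>i\<in>UNIV. A $ i $ j * t $ i)"

text \<open>Infinite products and sums start at index 0 in the library, hence the shift to Suc k.\<close>

definition F_fun :: "real^'n^'m \<Rightarrow> real^'n \<Rightarrow> real \<Rightarrow> real^'m \<Rightarrow> real" where
  "F_fun A b s t = (\<Prod>j\<in>UNIV. \<Prod>k. theta_factor (exp (- s)) (Suc k) (phase A b j t))"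

definition G_fun :: "real^'n^'m \<Rightarrow> real^'n \<Rightarrow> real \<Rightarrow> nat \<Rightarrow> real^'m \<Rightarrow> real" where
  "G_fun A b s K t =
     exp (- (norm t)\<^sup>2 / 2) *
     (\<Prod>j\<in>UNIV. \<Prod>k=1..K. theta_factor (exp (- s)) k (phase A b j t))"

end

theory Submission
  imports Defs "HOL-Probability.Characteristic_Functions"
begin

text \<open>
  The identity rests on the Jacobi triple product, which expands each of the \<open>n\<close> factors of \<open>F\<close> as a
  Fourier series \<open>\<Sum>\<^sub>k q\<^bsup>k\<^sup>2\<^esup> e\<^bsup>ik\<theta>\<^esup>\<close>, up to the constant \<open>\<Prod>\<^sub>k (1 - q\<^bsup>2k\<^esup>)\<close>. Their product is a sum
  over lattice points \<open>x\<close> of \<open>exp (- s \<parallel>x\<parallel>\<^sup>2 + i \<langle>b, x\<rangle> + i \<langle>A x, t\<rangle>)\<close>, and the Gaussian average of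
  \<open>exp (i \<langle>A x, t\<rangle>)\<close> is \<open>exp (- \<parallel>A x\<parallel>\<^sup>2 / 2)\<close>, which completes \<open>s \<parallel>x\<parallel>\<^sup>2\<close> to \<open>\<langle>B x, x\<rangle>\<close>. Interchanging an
  infinite sum with the integral is avoided by truncating the product after \<open>N\<close> factors: then the
  expansion is finite (\<open>finite_jacobi_triple_product\<close>) and is integrated term by term
  (\<open>integral_G_fun\<close>). The integrands are dominated by a multiple of the Gaussian and the terms of the
  sums by a multiple of \<open>exp (- s \<parallel>x\<parallel>\<^sup>2)\<close>, so both sides converge as \<open>N\<close> tends to infinity
  (\<open>gaussian_theta_identity\<close>).

  For log-concavity, the logarithm of \<open>1 + 2 r cos u + r\<^sup>2\<close> has second derivative at most
  \<open>2 r / (1 - r)\<^sup>2\<close> (\<open>theta_log_concave_defect\<close>). In a direction \<open>h\<close> the logarithm of the product thus has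
  second derivative at most \<open>2 S \<parallel>A\<^sup>T h\<parallel>\<^sup>2 \<le> 2 S \<parallel>A\<^sup>T A\<parallel> \<parallel>h\<parallel>\<^sup>2\<close>, where \<open>S\<close> sums \<open>r / (1 - r)\<^sup>2\<close> over the
  odd powers \<open>r\<close> of \<open>q\<close>; the Gaussian contributes \<open>- \<parallel>h\<parallel>\<^sup>2\<close>, and the hypothesis makes the total nonpositive.
  The statement about the infinite product follows by passing to the limit.
\<close>

section \<open>A finite form of the Jacobi triple product\<close>

text \<open>
  In the usual notation this is the \<open>q\<close>-Pochhammer symbol \<open>(q\<^sup>2; q\<^sup>2)\<^sub>N\<close>.
\<close>

definition qpoch :: "real \<Rightarrow> nat \<Rightarrow> real" where
  "qpoch q N = (\<Prod>k<N. 1 - q ^ (2 * Suc k))"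

text \<open>
  The reciprocal of the \<open>q\<close>-Pochhammer symbol vanishes at negative integers for the same reason as
  that of the factorial: it is the only extension that keeps the recurrence \<open>inv_qpoch_step\<close> valid
  for every integer. With it the coefficients below need no case distinction at the ends of their range.
\<close>

definition inv_qpoch :: "real \<Rightarrow> int \<Rightarrow> real" where
  "inv_qpoch q i = (if i < 0 then 0 else 1 / qpoch q (nat i))"

text \<open>
  This is the Gaussian binomial coefficient \<open>2N\<close> over \<open>N + k\<close> in base \<open>q\<^sup>2\<close>.
\<close>

definition jacobi_coeff :: "real \<Rightarrow> nat \<Rightarrow> int \<Rightarrow> real" where
  "jacobi_coeff q N k = qpoch q (2 * N) * inv_qpoch q (int N - k) * inv_qpoch q (int N + k)"

lemma qpoch_pos:
  assumes "0 < q" "q < 1"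
  shows "0 < qpoch q N"
  unfolding qpoch_def using assms by (intro prod_pos) (simp add: power_less_one_iff del: mult_Suc_right)

lemma qpoch_Suc: "qpoch q (Suc N) = qpoch q N * (1 - q ^ (2 * Suc N))"
  by (simp add: qpoch_def)

lemma inv_qpoch_step:
  assumes "0 < q" "q < 1"
  shows "inv_qpoch q (i - 1) = (1 - q powi (2 * i)) * inv_qpoch q i"
proof (cases "i \<le> 0")
  case True
  then show ?thesis by (cases "i = 0") (auto simp: inv_qpoch_def)
next
  case False
  define n where "n = nat (i - 1)"
  have i: "i = int (Suc n)" using False by (simp add: n_def)
  have "q powi (2 * i) = q ^ (2 * Suc n)"
  proof -
    have "2 * i = int (2 * Suc n)" unfolding i by simp
    then show ?thesis by (simp only: power_int_of_nat)
  qed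
  moreover have "1 - q ^ (2 * Suc n) > 0"
    using assms by (simp add: power_less_one_iff del: mult_Suc_right)
  ultimately show ?thesis
    using qpoch_pos[OF assms, of n]
    by (simp add: inv_qpoch_def i nat_add_distrib qpoch_Suc del: mult_Suc_right)
qed

lemma jacobi_coeff_zero: "\<bar>k\<bar> > int N \<Longrightarrow> jacobi_coeff q N k = 0"
  by (auto simp: jacobi_coeff_def inv_qpoch_def)

text \<open>
  Multiplying a Laurent polynomial \<open>\<Sum>\<^sub>k a\<^sub>k w\<^sup>k\<close> by \<open>1 + r (w + 1/w) + r\<^sup>2\<close>, where \<open>r = q\<^bsup>2N+1\<^esup>\<close>, turns the
  coefficient \<open>a\<^sub>k\<close> into the right-hand side below, so this recurrence is the induction step of the
  finite triple product identity. All four coefficients are multiples of one number \<open>u\<close>, which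
  leaves a polynomial identity in \<open>q\<close>, \<open>X = q\<^bsup>2k\<^esup>\<close> and \<open>Y = q\<^bsup>2N\<^esup>\<close>.
\<close>

lemma jacobi_coeff_Suc:
  fixes q :: real and k :: int
  assumes q: "0 < q" "q < 1"
  shows "jacobi_coeff q (Suc N) k * q powi k\<^sup>2 =
     (1 + q ^ (4 * N + 2)) * (jacobi_coeff q N k * q powi k\<^sup>2) +
     q ^ (2 * N + 1) * (jacobi_coeff q N (k - 1) * q powi (k - 1)\<^sup>2 +
                        jacobi_coeff q N (k + 1) * q powi (k + 1)\<^sup>2)"
proof -
  define X where "X = q powi (2 * k)"
  define Y where "Y = q ^ (2 * N)"
  define E where "E = q powi k\<^sup>2"
  have nz: "q \<noteq> 0" "X \<noteq> 0" using q by (auto simp: X_def)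
  have sq1: "(k - 1)\<^sup>2 = k\<^sup>2 + 1 - 2 * k" and sq2: "(k + 1)\<^sup>2 = k\<^sup>2 + 1 + 2 * k"
    by (simp_all add: power2_eq_square algebra_simps)
  have E1: "q powi (k - 1)\<^sup>2 = E * q / X" and E2: "q powi (k + 1)\<^sup>2 = E * q * X"
    unfolding sq1 sq2 using nz by (simp_all add: power_int_add power_int_diff X_def E_def)
  have YN: "q powi (2 * int N) = Y"
  proof -
    have "2 * int N = int (2 * N)" by simp
    then show ?thesis unfolding Y_def by (simp only: power_int_of_nat)
  qed
  have pw: "q powi (2 * (int N + 1 - k)) = Y * q\<^sup>2 / X" "q powi (2 * (int N - k)) = Y / X"
     "q powi (2 * (int N + 1 + k)) = Y * q\<^sup>2 * X" "q powi (2 * (int N + k)) = Y * X"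
    using nz YN by (simp_all add: power_int_add power_int_diff X_def algebra_simps)
  define u where "u = inv_qpoch q (int N + 1 - k) * inv_qpoch q (int N + 1 + k)"
  have st: "inv_qpoch q (int N - k) = (1 - Y * q\<^sup>2 / X) * inv_qpoch q (int N + 1 - k)"
     "inv_qpoch q (int N - k - 1) = (1 - Y / X) * inv_qpoch q (int N - k)"
     "inv_qpoch q (int N + k) = (1 - Y * q\<^sup>2 * X) * inv_qpoch q (int N + 1 + k)"
     "inv_qpoch q (int N + k - 1) = (1 - Y * X) * inv_qpoch q (int N + k)"
    using inv_qpoch_step[OF q, of "int N + 1 - k"] inv_qpoch_step[OF q, of "int N - k"]
      inv_qpoch_step[OF q, of "int N + 1 + k"] inv_qpoch_step[OF q, of "int N + k"]
    unfolding pw by (simp_all add: algebra_simps)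
  define P where "P = qpoch q (2 * N)"
  have P2: "qpoch q (2 * Suc N) = P * (1 - Y\<^sup>2 * q\<^sup>2) * (1 - Y\<^sup>2 * q ^ 4)"
  proof -
    have "q ^ (2 * Suc (2 * N)) = Y\<^sup>2 * q\<^sup>2" "q ^ (2 * Suc (Suc (2 * N))) = Y\<^sup>2 * q ^ 4"
      by (simp_all add: Y_def numeral_eq_Suc flip: power_mult power_add)
    moreover have "2 * Suc N = Suc (Suc (2 * N))" by simp
    ultimately show ?thesis by (simp only: qpoch_Suc P_def)
  qed
  have c0: "jacobi_coeff q (Suc N) k = P * (1 - Y\<^sup>2 * q\<^sup>2) * (1 - Y\<^sup>2 * q ^ 4) * u"
    unfolding jacobi_coeff_def P2 u_def by (simp add: algebra_simps)
  have c1: "jacobi_coeff q N k = P * (1 - Y * q\<^sup>2 / X) * (1 - Y * q\<^sup>2 * X) * u"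
    unfolding jacobi_coeff_def st P_def[symmetric] u_def by (simp only: mult_ac)
  have c2: "jacobi_coeff q N (k - 1) = P * (1 - Y * X) * (1 - Y * q\<^sup>2 * X) * u"
  proof -
    have "int N - (k - 1) = int N + 1 - k" "int N + (k - 1) = int N + k - 1" by auto
    then show ?thesis unfolding jacobi_coeff_def
      by (simp only: st P_def u_def mult_ac)
  qed
  have c3: "jacobi_coeff q N (k + 1) = P * (1 - Y / X) * (1 - Y * q\<^sup>2 / X) * u"
  proof -
    have "int N - (k + 1) = int N - k - 1" "int N + (k + 1) = int N + 1 + k" by auto
    then show ?thesis unfolding jacobi_coeff_def
      by (simp only: st P_def u_def mult_ac)
  qed
  have p1: "q ^ (4 * N + 2) = Y\<^sup>2 * q\<^sup>2" and p2: "q ^ (2 * N + 1) = Y * q"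
  proof -
    have "4 * N + 2 = 2 * N * 2 + 2" by simp
    then show "q ^ (4 * N + 2) = Y\<^sup>2 * q\<^sup>2" unfolding Y_def by (simp only: power_add power_mult)
    show "q ^ (2 * N + 1) = Y * q" by (simp add: Y_def)
  qed
  have "(1 - Y\<^sup>2 * q\<^sup>2) * (1 - Y\<^sup>2 * q ^ 4) =
      (1 + Y\<^sup>2 * q\<^sup>2) * ((1 - Y * q\<^sup>2 / X) * (1 - Y * q\<^sup>2 * X)) +
      Y * q * ((1 - Y * X) * (1 - Y * q\<^sup>2 * X) * (q / X) + (1 - Y / X) * (1 - Y * q\<^sup>2 / X) * (q * X))"
    using nz by (simp add: field_simps) algebra
  \<comment> \<open>Multiplies the identity by \<open>P u E\<close>; with its factors as atoms, no division has to be rearranged.\<close>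
  moreover have "P * a1 * a2 * u * E = b * (P * b1 * b2 * u * E) +
      r * (P * d1 * d2 * u * (E * q / X) + P * e1 * e2 * u * (E * q * X))"
    if "a1 * a2 = b * (b1 * b2) + r * (d1 * d2 * (q / X) + e1 * e2 * (q * X))"
    for a1 a2 b b1 b2 r d1 d2 e1 e2
  proof -
    have "P * a1 * a2 * u * E = P * u * E * (a1 * a2)" by simp
    then show ?thesis unfolding that by (simp add: algebra_simps)
  qed
  ultimately show ?thesis
    unfolding c0 c1 c2 c3 p1 p2 E1 E2 E_def[symmetric] by blast
qed

text \<open>
  The \<open>q\<close>-binomial theorem in symmetric form, at \<open>w = e\<^bsup>i\<theta>\<^esup>\<close>. As \<open>N\<close> grows it becomes the Jacobi
  triple product, but only the finite identity is used: a finite sum can be integrated term by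
  term, and the limit is then taken after the integration.
\<close>

lemma finite_jacobi_triple_product:
  fixes q :: real
  assumes q: "0 < q" "q < 1"
  shows "complex_of_real (\<Prod>k=1..N. theta_factor q k \<theta>) =
    (\<Sum>k\<in>{- int N..int N}. of_real (jacobi_coeff q N k * q powi k\<^sup>2) * cis (of_int k * \<theta>))"
proof (induction N)
  case 0
  show ?case by (simp add: jacobi_coeff_def inv_qpoch_def qpoch_def)
next
  case (Suc N)
  define a where "a n k = complex_of_real (jacobi_coeff q n k * q powi k\<^sup>2)" for n k
  define c where "c k = cis (of_int k * \<theta>)" for k
  define J where "J = {- int (Suc N)..int (Suc N)}"
  have a0: "a n k = 0" if "\<bar>k\<bar> > int n" for n k
    using that by (simp add: a_def jacobi_coeff_zero)
  have S: "(\<Sum>k\<in>{- int N..int N}. a N k * c k) = (\<Sum>k\<in>J. a N k * c k)"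
    unfolding J_def by (rule sum.mono_neutral_left) (auto simp: a0)
  have Sp: "(\<Sum>k\<in>{- int N..int N}. a N k * c (k + 1)) = (\<Sum>k\<in>J. a N (k - 1) * c k)"
  proof -
    have "(\<Sum>k\<in>{- int N..int N}. a N k * c (k + 1)) = (\<Sum>k\<in>{- int N + 1..int N + 1}. a N (k - 1) * c k)"
      by (rule sum.reindex_bij_witness[of _ "\<lambda>k. k - 1" "\<lambda>k. k + 1"]) auto
    also have "\<dots> = (\<Sum>k\<in>J. a N (k - 1) * c k)"
      unfolding J_def by (rule sum.mono_neutral_left) (auto intro!: a0)
    finally show ?thesis .
  qed
  have Sm: "(\<Sum>k\<in>{- int N..int N}. a N k * c (k - 1)) = (\<Sum>k\<in>J. a N (k + 1) * c k)"
  proof -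
    have "(\<Sum>k\<in>{- int N..int N}. a N k * c (k - 1)) = (\<Sum>k\<in>{- int N - 1..int N - 1}. a N (k + 1) * c k)"
      by (rule sum.reindex_bij_witness[of _ "\<lambda>k. k + 1" "\<lambda>k. k - 1"]) auto
    also have "\<dots> = (\<Sum>k\<in>J. a N (k + 1) * c k)"
      unfolding J_def by (rule sum.mono_neutral_left) (auto intro!: a0)
    finally show ?thesis .
  qed
  have cc: "c k * complex_of_real (2 * cos \<theta>) = c (k + 1) + c (k - 1)" for k
    by (simp add: c_def complex_eq_iff algebra_simps cos_add cos_diff sin_add sin_diff)
  define r where "r = q ^ (2 * N + 1)"
  have th: "theta_factor q (Suc N) \<theta> = (1 + q ^ (4 * N + 2)) + r * (2 * cos \<theta>)"
    by (simp add: theta_factor_def r_def)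
  have "complex_of_real (\<Prod>k=1..Suc N. theta_factor q k \<theta>) =
      (\<Sum>k\<in>{- int N..int N}. a N k * c k) * of_real ((1 + q ^ (4 * N + 2)) + r * (2 * cos \<theta>))"
    using Suc.IH by (simp add: th a_def c_def)
  also have "\<dots> = of_real (1 + q ^ (4 * N + 2)) * (\<Sum>k\<in>{- int N..int N}. a N k * c k)
       + of_real r * (\<Sum>k\<in>{- int N..int N}. a N k * (c k * complex_of_real (2 * cos \<theta>)))"
    by (simp only: of_real_add of_real_mult ring_distribs sum_distrib_left sum_distrib_right mult_ac)
  also have "\<dots> = of_real (1 + q ^ (4 * N + 2)) * (\<Sum>k\<in>J. a N k * c k)
       + of_real r * ((\<Sum>k\<in>J. a N (k - 1) * c k) + (\<Sum>k\<in>J. a N (k + 1) * c k))"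
    unfolding cc S by (simp only: ring_distribs sum.distrib Sp Sm)
  also have "\<dots> = (\<Sum>k\<in>J. (of_real (1 + q ^ (4 * N + 2)) * a N k + of_real r * (a N (k - 1) + a N (k + 1))) * c k)"
    by (simp only: ring_distribs sum.distrib sum_distrib_left mult.assoc)
  also have "\<dots> = (\<Sum>k\<in>J. a (Suc N) k * c k)"
  proof (rule sum.cong[OF refl])
    fix k
    have "of_real (1 + q ^ (4 * N + 2)) * a N k + of_real r * (a N (k - 1) + a N (k + 1)) = a (Suc N) k"
      unfolding a_def r_def jacobi_coeff_Suc[OF q] by simp
    then show "(of_real (1 + q ^ (4 * N + 2)) * a N k + of_real r * (a N (k - 1) + a N (k + 1))) * c k
       = a (Suc N) k * c k" by simp
  qed
  finally show ?case by (simp add: a_def c_def J_def)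
qed

section \<open>Limits of the coefficients\<close>

lemma convergent_prod_qpoch:
  assumes q: "0 < q" "q < (1::real)"
  shows "convergent_prod (\<lambda>k. 1 - q ^ (2 * Suc k))"
proof (intro abs_convergent_prod_imp_convergent_prod summable_imp_abs_convergent_prod)
  show "summable (\<lambda>k. norm (1 - q ^ (2 * Suc k) - 1))"
  proof (rule summable_comparison_test'[of "\<lambda>k. q ^ k" 0])
    show "summable (\<lambda>k. q ^ k)" using q by (intro summable_geometric) auto
    fix k
    have "q ^ (2 * Suc k) \<le> q ^ k" using q by (intro power_decreasing) auto
    then show "norm (norm (1 - q ^ (2 * Suc k) - 1)) \<le> q ^ k" using q by (simp del: mult_Suc_right)
  qed
qed

definition qpoch_inf :: "real \<Rightarrow> real" where
  "qpoch_inf q = (\<Prod>k. 1 - q ^ (2 * Suc k))"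

lemma
  assumes q: "0 < q" "q < 1"
  shows qpoch_tendsto: "qpoch q \<longlonglongrightarrow> qpoch_inf q"
    and qpoch_inf_le: "qpoch_inf q \<le> qpoch q N"
    and qpoch_inf_pos: "0 < qpoch_inf q"
proof -
  note c = convergent_prod_qpoch[OF q]
  have f: "0 < 1 - q ^ (2 * Suc k) \<and> 1 - q ^ (2 * Suc k) < 1" for k
    using q by (simp add: power_less_one_iff del: mult_Suc_right)
  have "(\<lambda>n. \<Prod>k<n. 1 - q ^ (2 * Suc k)) \<longlonglongrightarrow> qpoch_inf q"
    using convergent_prod_LIMSEQ[OF c] by (simp add: LIMSEQ_lessThan_iff_atMost qpoch_inf_def)
  then show "qpoch q \<longlonglongrightarrow> qpoch_inf q"
    by (simp add: qpoch_def[abs_def])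
  show "qpoch_inf q \<le> qpoch q N"
    unfolding qpoch_def qpoch_inf_def
    by (rule prod_ge_prodinf[OF convergent_prod_has_prod[OF c]]) (use f less_imp_le in \<open>blast+\<close>)
  have "qpoch_inf q \<noteq> 0"
    unfolding qpoch_inf_def by (rule prodinf_nonzero[OF c]) (use f less_irrefl in metis)
  moreover have "0 \<le> qpoch_inf q"
    by (rule LIMSEQ_le_const[OF \<open>qpoch q \<longlonglongrightarrow> qpoch_inf q\<close>]) (use qpoch_pos[OF q] less_imp_le in blast)
  ultimately show "0 < qpoch_inf q" by simp
qed

text \<open>
  The upper bound is independent of \<open>N\<close> and \<open>k\<close>, as the domination of the lattice sums demands.
\<close>

lemma jacobi_coeff_bounds:
  assumes q: "0 < q" "q < 1"
  shows "0 \<le> jacobi_coeff q N k" "jacobi_coeff q N k \<le> (1 / qpoch_inf q)\<^sup>2"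
proof -
  have i: "0 \<le> inv_qpoch q i" "inv_qpoch q i \<le> 1 / qpoch_inf q" for i
    using qpoch_inf_le[OF q] qpoch_inf_pos[OF q] qpoch_pos[OF q]
    by (auto simp: inv_qpoch_def frac_le less_imp_le)
  have "qpoch q (2 * N) \<le> 1"
    unfolding qpoch_def using q
    by (intro prod_le_1) (auto simp: power_le_one simp del: mult_Suc_right)
  then have "jacobi_coeff q N k \<le> 1 * (1 / qpoch_inf q) * (1 / qpoch_inf q)"
    unfolding jacobi_coeff_def using i qpoch_inf_pos[OF q]
    by (intro mult_mono) auto
  then show "jacobi_coeff q N k \<le> (1 / qpoch_inf q)\<^sup>2" by (simp add: power2_eq_square)
  show "0 \<le> jacobi_coeff q N k"
    unfolding jacobi_coeff_def using i qpoch_pos[OF q, of "2 * N"] by simp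
qed

lemma jacobi_coeff_tendsto:
  assumes q: "0 < q" "q < 1"
  shows "(\<lambda>N. jacobi_coeff q N k) \<longlonglongrightarrow> 1 / qpoch_inf q"
proof -
  have inv: "(\<lambda>N. inv_qpoch q (int N + i)) \<longlonglongrightarrow> 1 / qpoch_inf q" for i
  proof -
    have "filterlim (\<lambda>N. nat (int N + i)) sequentially sequentially"
      unfolding filterlim_at_top
    proof
      fix Z show "\<forall>\<^sub>F N in sequentially. Z \<le> nat (int N + i)"
        using eventually_ge_at_top[of "Z + nat (\<bar>i\<bar>)"] by eventually_elim auto
    qed
    then have "(\<lambda>N. 1 / qpoch q (nat (int N + i))) \<longlonglongrightarrow> 1 / qpoch_inf q"
      using qpoch_inf_pos[OF q]
      by (intro tendsto_intros filterlim_compose[OF qpoch_tendsto[OF q]]) auto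
    moreover have "\<forall>\<^sub>F N in sequentially. 1 / qpoch q (nat (int N + i)) = inv_qpoch q (int N + i)"
      using eventually_ge_at_top[of "nat (\<bar>i\<bar>)"]
      by eventually_elim (auto simp: inv_qpoch_def)
    ultimately show ?thesis by (rule Lim_transform_eventually)
  qed
  have "filterlim (\<lambda>N::nat. 2 * N) sequentially sequentially"
    by (intro filterlim_subseq) (auto simp: strict_mono_def)
  then have "(\<lambda>N. qpoch q (2 * N)) \<longlonglongrightarrow> qpoch_inf q"
    by (rule filterlim_compose[OF qpoch_tendsto[OF q]])
  from tendsto_mult[OF tendsto_mult[OF this inv[of "- k"]] inv[of k]]
  show ?thesis using qpoch_inf_pos[OF q] by (simp add: jacobi_coeff_def)
qed

section \<open>The infinite theta product\<close>

lemma theta_factor_Suc: "theta_factor q (Suc k) \<theta> = 1 + 2 * q ^ (2 * k + 1) * cos \<theta> + (q ^ (2 * k + 1))\<^sup>2"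
proof -
  have "2 * Suc k - 1 = 2 * k + 1" "4 * Suc k - 2 = (2 * k + 1) * 2" by auto
  then show ?thesis unfolding theta_factor_def by (simp only: power_mult)
qed

lemma theta_factor_pos:
  assumes q: "0 < q" "q < 1"
  shows "0 < theta_factor q (Suc k) \<theta>"
proof -
  define r where "r = q ^ (2 * k + 1)"
  have r: "0 < r" "r < 1" using q power_less_one_iff[of q "2 * k + 1"] by (auto simp: r_def)
  have "0 < (1 - r)\<^sup>2" using r by simp
  also have "\<dots> = 1 + 2 * r * (-1) + r\<^sup>2" by (simp add: power2_eq_square algebra_simps)
  also have "\<dots> \<le> 1 + 2 * r * cos \<theta> + r\<^sup>2"
    using r by (intro add_mono mult_left_mono) auto
  finally show ?thesis by (simp add: theta_factor_Suc r_def)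
qed

lemma convergent_prod_theta_factor:
  assumes q: "0 < q" "q < 1"
  shows "convergent_prod (\<lambda>k. theta_factor q (Suc k) \<theta>)"
proof (intro abs_convergent_prod_imp_convergent_prod summable_imp_abs_convergent_prod)
  show "summable (\<lambda>k. norm (theta_factor q (Suc k) \<theta> - 1))"
  proof (rule summable_comparison_test'[of "\<lambda>k. 3 * q ^ k" 0])
    show "summable (\<lambda>k. 3 * q ^ k)" using q by (intro summable_mult summable_geometric) auto
    fix k
    define r where "r = q ^ (2 * k + 1)"
    have r: "0 < r" "r < 1" using q power_less_one_iff[of q "2 * k + 1"] by (auto simp: r_def)
    have rk: "r \<le> q ^ k" unfolding r_def using q by (intro power_decreasing) auto
    have "\<bar>2 * r * cos \<theta> + r\<^sup>2\<bar> \<le> \<bar>2 * r * cos \<theta>\<bar> + \<bar>r\<^sup>2\<bar>" by (rule abs_triangle_ineq)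
    also have "\<dots> \<le> 2 * r * 1 + r * 1"
      unfolding abs_mult power2_eq_square using r by (intro add_mono mult_mono) auto
    finally show "norm (norm (theta_factor q (Suc k) \<theta> - 1)) \<le> 3 * q ^ k"
      using r rk by (simp add: theta_factor_Suc r_def)
  qed
qed

lemma theta_prod_tendsto:
  assumes q: "0 < q" "q < 1"
  shows "(\<lambda>K. \<Prod>k=1..K. theta_factor q k \<theta>) \<longlonglongrightarrow> (\<Prod>k. theta_factor q (Suc k) \<theta>)"
  using convergent_prod_LIMSEQ[OF convergent_prod_theta_factor[OF q, of \<theta>]]
  by (simp add: LIMSEQ_lessThan_iff_atMost prod.atLeast1_atMost_eq)

text \<open>
  Each factor is largest at \<open>\<theta> = 0\<close>, and there it is at least 1, so the truncations at \<open>0\<close> increase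
  to the infinite product.
\<close>

lemma theta_prod_bound:
  assumes q: "0 < q" "q < 1"
  shows "(\<Prod>k=1..K. theta_factor q k \<theta>) \<le> (\<Prod>k. theta_factor q (Suc k) 0)"
proof -
  have "(\<Prod>k<K. theta_factor q (Suc k) \<theta>) \<le> (\<Prod>k<K. theta_factor q (Suc k) 0)"
    using q theta_factor_pos[OF q] by (intro prod_mono) (auto simp: less_imp_le theta_factor_Suc)
  also have "\<dots> \<le> (\<Prod>k. theta_factor q (Suc k) 0)"
    using q by (intro prod_le_prodinf[OF convergent_prod_has_prod[OF convergent_prod_theta_factor[OF q]]])
      (auto simp: theta_factor_Suc)
  finally show ?thesis by (simp add: prod.atLeast1_atMost_eq)
qed

lemma theta_prodinf_pos:
  assumes q: "0 < q" "q < 1"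
  shows "0 < (\<Prod>k. theta_factor q (Suc k) \<theta>)"
  by (rule less_0_prodinf[OF convergent_prod_theta_factor[OF q]]) (rule theta_factor_pos[OF q])

section \<open>Fourier transform of the Gaussian, and sums over lattices\<close>

lemma
  fixes y :: real
  shows integrable_gaussian_fourier_real:
      "integrable lborel (\<lambda>u. cis (y * u) * complex_of_real (exp (- u\<^sup>2 / 2)))"
    and integral_gaussian_fourier_real:
      "(LINT u|lborel. cis (y * u) * complex_of_real (exp (- u\<^sup>2 / 2))) =
        complex_of_real (sqrt (2 * pi) * exp (- y\<^sup>2 / 2))"
proof -
  have g: "exp (- u\<^sup>2 / 2) = sqrt (2 * pi) * std_normal_density u" for u :: real
    by (simp add: std_normal_density_def)
  have "integrable lborel (\<lambda>u. sqrt (2 * pi) * std_normal_density u)" by simp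
  then have int: "integrable lborel (\<lambda>u::real. exp (- u\<^sup>2 / 2))" by (simp only: g)
  show "integrable lborel (\<lambda>u. cis (y * u) * complex_of_real (exp (- u\<^sup>2 / 2)))"
    by (rule Bochner_Integration.integrable_bound[OF int])
       (auto simp: norm_mult cis_conv_exp intro!: borel_measurable_continuous_onI continuous_intros)
  have "char std_normal_distribution y = (LINT u|lborel. std_normal_density u *\<^sub>R iexp (y * u))"
    unfolding char_def
    by (subst integral_density) (auto simp: normal_density_nonneg)
  also have "complex_of_real (sqrt (2 * pi)) * \<dots> =
      (LINT u|lborel. complex_of_real (sqrt (2 * pi)) * (std_normal_density u *\<^sub>R iexp (y * u)))"
    by (rule integral_mult_right_zero[symmetric])
  also have "\<dots> = (LINT u|lborel. cis (y * u) * complex_of_real (exp (- u\<^sup>2 / 2)))"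
    unfolding g by (intro Bochner_Integration.integral_cong) (auto simp: cis_conv_exp scaleR_conv_of_real)
  finally show "(LINT u|lborel. cis (y * u) * complex_of_real (exp (- u\<^sup>2 / 2))) =
        complex_of_real (sqrt (2 * pi) * exp (- y\<^sup>2 / 2))"
    by (simp add: char_std_normal_distribution)
qed

text \<open>
  Both the Gaussian and the exponential factor over the coordinates of an orthonormal basis, and
  Lebesgue measure is the image of a product measure; so the integral is a product of
  one-dimensional ones, and these are, up to the factor \<open>sqrt (2 \<pi>)\<close>, values of the characteristic
  function of the standard normal distribution.
\<close>

lemma
  fixes y :: "'a::euclidean_space"
  shows integrable_gaussian_fourier:
      "integrable lborel (\<lambda>t. cis (y \<bullet> t) * complex_of_real (exp (- (norm t)\<^sup>2 / 2)))"
    and integral_gaussian_fourier: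
      "(LINT t|lborel. cis (y \<bullet> t) * complex_of_real (exp (- (norm t)\<^sup>2 / 2))) =
        complex_of_real ((2 * pi) powr (real DIM('a) / 2) * exp (- (norm y)\<^sup>2 / 2))"
proof -
  define f :: "'a \<Rightarrow> real \<Rightarrow> complex" where
    "f i u = cis ((y \<bullet> i) * u) * complex_of_real (exp (- u\<^sup>2 / 2))" for i u
  define T :: "('a \<Rightarrow> real) \<Rightarrow> 'a" where "T x = (\<Sum>b\<in>Basis. x b *\<^sub>R b)" for x
  interpret product_sigma_finite "\<lambda>_::'a. lborel :: real measure" ..
  have inner: "T x \<bullet> b = x b" if "b \<in> Basis" for x b
    using that by (simp add: T_def inner_sum_left inner_Basis if_distrib sum.delta' cong: if_cong)
  have prod: "cis (y \<bullet> T x) * complex_of_real (exp (- (norm (T x))\<^sup>2 / 2)) = (\<Prod>i\<in>Basis. f i (x i))" for x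
  proof -
    have "y \<bullet> T x = (\<Sum>i\<in>Basis. (y \<bullet> i) * x i)"
      by (subst euclidean_inner) (simp add: inner)
    then have c: "cis (y \<bullet> T x) = (\<Prod>i\<in>Basis. cis ((y \<bullet> i) * x i))"
      by (simp add: cis_conv_exp exp_sum sum_distrib_left)
    have "- (norm (T x))\<^sup>2 / 2 = (\<Sum>i\<in>Basis. - (x i)\<^sup>2 / 2)"
      unfolding power2_norm_eq_inner
      by (subst euclidean_inner) (simp add: inner power2_eq_square sum_divide_distrib sum_negf)
    then have e: "exp (- (norm (T x))\<^sup>2 / 2) = (\<Prod>i\<in>Basis. exp (- (x i)\<^sup>2 / 2))"
      by (simp only: exp_sum finite_Basis)
    show ?thesis by (simp only: f_def prod.distrib c e of_real_prod)
  qed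
  have T[measurable]: "T \<in> measurable (Pi\<^sub>M Basis (\<lambda>_. lborel)) borel"
    unfolding T_def[abs_def] by measurable
  have lb: "(lborel :: 'a measure) = distr (Pi\<^sub>M Basis (\<lambda>_. lborel)) borel T"
    unfolding T_def[abs_def] by (rule lborel_eq)
  have meas: "(\<lambda>t. cis (y \<bullet> t) * complex_of_real (exp (- (norm t)\<^sup>2 / 2))) \<in> borel_measurable borel"
    unfolding cis_conv_exp by (intro borel_measurable_continuous_onI continuous_intros) simp
  have fi: "integrable lborel (f i)" for i
    unfolding f_def[abs_def] by (rule integrable_gaussian_fourier_real)
  show "integrable lborel (\<lambda>t. cis (y \<bullet> t) * complex_of_real (exp (- (norm t)\<^sup>2 / 2)))"
    unfolding lb by (subst integrable_distr_eq[OF T meas], unfold prod) (rule product_integrable_prod[OF finite_Basis fi])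
  have "(LINT t|lborel. cis (y \<bullet> t) * complex_of_real (exp (- (norm t)\<^sup>2 / 2))) =
      (LINT x|Pi\<^sub>M Basis (\<lambda>_. lborel). (\<Prod>i\<in>Basis. f i (x i)))"
    unfolding lb by (subst integral_distr[OF T meas]) (simp only: prod)
  also have "\<dots> = (\<Prod>i\<in>Basis. complex_of_real (sqrt (2 * pi) * exp (- (y \<bullet> i)\<^sup>2 / 2)))"
    by (subst product_integral_prod[OF finite_Basis fi]) (simp only: f_def[abs_def] integral_gaussian_fourier_real)
  also have "\<dots> = complex_of_real (sqrt (2 * pi) ^ DIM('a) * exp (\<Sum>i\<in>Basis. - (y \<bullet> i)\<^sup>2 / 2))"
    by (simp add: prod.distrib exp_sum)
  also have "(\<Sum>i\<in>Basis. - (y \<bullet> i)\<^sup>2 / 2) = - (norm y)\<^sup>2 / 2"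
    by (simp only: power2_norm_eq_inner euclidean_inner[of y y])
       (simp add: power2_eq_square sum_divide_distrib sum_negf)
  also have "sqrt (2 * pi) ^ DIM('a) = (2 * pi) powr (real DIM('a) / 2)"
    by (simp add: powr_half_sqrt[symmetric] powr_powr flip: powr_realpow)
  finally show "(LINT t|lborel. cis (y \<bullet> t) * complex_of_real (exp (- (norm t)\<^sup>2 / 2))) =
        complex_of_real ((2 * pi) powr (real DIM('a) / 2) * exp (- (norm y)\<^sup>2 / 2))" .
qed

text \<open>
  Dominated convergence for the counting measure.
\<close>

lemma tannery_infsum:
  fixes f :: "nat \<Rightarrow> 'a \<Rightarrow> 'b::{banach, second_countable_topology}"
  assumes g: "g summable_on A"
    and bound: "\<And>n x. x \<in> A \<Longrightarrow> norm (f n x) \<le> g x"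
    and lim: "\<And>x. x \<in> A \<Longrightarrow> (\<lambda>n. f n x) \<longlonglongrightarrow> h x"
  shows "(\<lambda>n. infsum (f n) A) \<longlonglongrightarrow> infsum h A"
proof -
  have ab: "(\<lambda>x. norm (k x)) summable_on A" if "\<And>x. x \<in> A \<Longrightarrow> norm (k x) \<le> g x" for k :: "'a \<Rightarrow> 'b"
    by (rule Infinite_Sum.abs_summable_on_comparison_test'[OF g that])
  have hb: "norm (h x) \<le> g x" if "x \<in> A" for x
    by (rule LIMSEQ_le_const2[OF tendsto_norm[OF lim[OF that]]]) (use bound[OF that] in auto)
  have gi: "integrable (count_space A) g"
    using summable_on_iff_abs_summable_on_real[THEN iffD1, OF g]
    unfolding abs_summable_equivalent abs_summable_on_def .
  have "(\<lambda>n. integral\<^sup>L (count_space A) (f n)) \<longlonglongrightarrow> integral\<^sup>L (count_space A) h"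
    by (rule integral_dominated_convergence[OF _ _ gi]) (auto simp: AE_count_space lim bound)
  moreover have "integral\<^sup>L (count_space A) k = infsum k A" if "\<And>x. x \<in> A \<Longrightarrow> norm (k x) \<le> g x" for k :: "'a \<Rightarrow> 'b"
    using infsetsum_infsum[of k A] ab[OF that] by (simp add: abs_summable_equivalent infsetsum_def)
  ultimately show ?thesis using bound hb by simp
qed

lemma summable_gaussian_int:
  fixes s :: real
  assumes s: "s > 0"
  shows "(\<lambda>k::int. exp (- s * (of_int k)\<^sup>2)) summable_on UNIV"
proof -
  have sn: "(\<lambda>n. exp (- s * (real n)\<^sup>2)) summable_on UNIV"
  proof (rule norm_summable_imp_summable_on, rule summable_comparison_test'[of "\<lambda>n. exp (- s) ^ n" 0])
    show "summable (\<lambda>n. exp (- s) ^ n)" using s by (intro summable_geometric) auto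
    fix n :: nat
    have "real n \<le> (real n)\<^sup>2" by (simp add: self_le_power power2_eq_square flip: of_nat_mult)
    then have "s * real n \<le> s * (real n)\<^sup>2" using s by (intro mult_left_mono) auto
    then show "norm (norm (exp (- s * (real n)\<^sup>2))) \<le> exp (- s) ^ n"
      by (simp add: mult.commute flip: exp_of_nat_mult)
  qed
  have "(\<lambda>k::int. exp (- s * (of_int k)\<^sup>2)) summable_on range int"
    using sn by (subst summable_on_reindex) (auto simp: o_def)
  moreover have "(\<lambda>k::int. exp (- s * (of_int k)\<^sup>2)) summable_on range (\<lambda>n. - int n)"
    using sn by (subst summable_on_reindex) (auto simp: o_def inj_on_def)
  ultimately have "(\<lambda>k::int. exp (- s * (of_int k)\<^sup>2)) summable_on range int \<union> range (\<lambda>n. - int n)"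
    by (rule summable_on_union)
  moreover have "k \<in> range int \<union> range (\<lambda>n. - int n)" for k :: int
    by (cases k rule: int_cases2) auto
  then have "range int \<union> range (\<lambda>n. - int n) = UNIV" by blast
  ultimately show ?thesis by simp
qed

text \<open>
  A function into the integers is a lattice point, and its Gaussian weight is a product over the
  coordinates; the sum therefore behaves like a power of the one-dimensional sum.
\<close>

lemma summable_gaussian_int_fun:
  fixes s :: real
  assumes s: "s > 0"
  shows "(\<lambda>x::'n::finite \<Rightarrow> int. \<Prod>j\<in>UNIV. exp (- s * (of_int (x j))\<^sup>2)) summable_on UNIV"
proof -
  have "Infinite_Set_Sum.abs_summable_on (\<lambda>k::int. exp (- s * (of_int k)\<^sup>2)) UNIV"
    using summable_gaussian_int[OF s] unfolding abs_summable_equivalent[symmetric] by simp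
  then have "Infinite_Set_Sum.abs_summable_on
      (\<lambda>x::'n \<Rightarrow> int. \<Prod>j\<in>UNIV. exp (- s * (of_int (x j))\<^sup>2)) (PiE UNIV (\<lambda>_. UNIV))"
    by (intro abs_summable_on_prod_PiE) auto
  then show ?thesis
    unfolding abs_summable_equivalent[symmetric] by (simp add: PiE_UNIV_domain abs_prod)
qed

section \<open>Log-concavity\<close>

text \<open>
  The function \<open>ln (1 + 2 r cos u + r\<^sup>2)\<close> is not concave, but its second derivative is at most
  \<open>2 r / (1 - r)\<^sup>2\<close>, the value at \<open>u = \<pi>\<close>. Subtracting the parabola \<open>r / (1 - r)\<^sup>2 u\<^sup>2\<close> makes it concave, and
  the last term of the inequality is what the parabola contributes to the convexity defect. The
  defect of \<open>\<parallel>t\<parallel>\<^sup>2 / 2\<close> has the same shape, so the two can be compared directly.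
\<close>

lemma theta_log_concave_defect:
  fixes r :: real
  assumes r: "0 < r" "r < 1" and a: "0 \<le> a" "a \<le> 1"
  shows "ln (1 + 2 * r * cos (a * x + (1 - a) * y) + r\<^sup>2) \<ge>
     a * ln (1 + 2 * r * cos x + r\<^sup>2) + (1 - a) * ln (1 + 2 * r * cos y + r\<^sup>2)
     - r / (1 - r)\<^sup>2 * (a * (1 - a) * (x - y)\<^sup>2)"
proof -
  define c where "c = r / (1 - r)\<^sup>2"
  define D where "D u = 1 + 2 * r * cos u + r\<^sup>2" for u
  have sq: "(1 - r)\<^sup>2 > 0" using r by simp
  have Dge: "D u \<ge> (1 - r)\<^sup>2" for u
  proof -
    have "r * (-1) \<le> r * cos u" using r by (intro mult_left_mono) auto
    then show ?thesis by (simp add: D_def power2_eq_square algebra_simps)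
  qed
  have Dpos: "D u > 0" for u using Dge[of u] sq by linarith
  have conc: "concave_on UNIV (\<lambda>u. ln (D u) - c * u\<^sup>2)"
  proof (rule f''_le0_imp_concave)
    fix u :: real
    show "((\<lambda>u. ln (D u) - c * u\<^sup>2) has_real_derivative (- 2 * r * sin u / D u - 2 * c * u)) (at u)"
      using Dpos[of u] unfolding D_def
      by (auto intro!: derivative_eq_intros simp: power2_eq_square)
    show "((\<lambda>u. - 2 * r * sin u / D u - 2 * c * u) has_real_derivative
       ((- 2 * r * cos u * D u - 4 * r\<^sup>2 * (sin u)\<^sup>2) / (D u)\<^sup>2 - 2 * c)) (at u)"
    proof -
      have "(D has_real_derivative - 2 * r * sin u) (at u)"
        unfolding D_def by (auto intro!: derivative_eq_intros)
      moreover have "((\<lambda>u. - 2 * r * sin u) has_real_derivative - 2 * r * cos u) (at u)"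
        by (auto intro!: derivative_eq_intros)
      ultimately have "((\<lambda>u. - 2 * r * sin u / D u) has_real_derivative
         ((- 2 * r * cos u) * D u - (- 2 * r * sin u) * (- 2 * r * sin u)) / (D u * D u)) (at u)"
        using Dpos[of u] by (intro DERIV_divide) auto
      moreover have "((\<lambda>u. 2 * c * u) has_real_derivative 2 * c) (at u)"
        by (auto intro!: derivative_eq_intros)
      ultimately have "((\<lambda>u. - 2 * r * sin u / D u - 2 * c * u) has_real_derivative
         ((- 2 * r * cos u) * D u - (- 2 * r * sin u) * (- 2 * r * sin u)) / (D u * D u) - 2 * c) (at u)"
        by (rule DERIV_diff)
      then show ?thesis by (simp add: power2_eq_square mult_ac)
    qed
    \<comment> \<open>Multiplied by \<open>2 r / (D u)\<^sup>2\<close>, the left-hand side is the second derivative of \<open>ln (D u)\<close>, and the right-hand side is \<open>2 c\<close>.\<close>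
    have key: "- ((1 + r\<^sup>2) * cos u) - 2 * r \<le> (D u)\<^sup>2 / (1 - r)\<^sup>2"
    proof -
      \<comment> \<open>This quantity is the difference of the two sides of the next inequality.\<close>
      have "0 \<le> (1 + r)\<^sup>2 * (1 + cos u)" by (intro mult_nonneg_nonneg) (auto simp: cos_ge_minus_one add.commute real_0_le_add_iff)
      then have "- ((1 + r\<^sup>2) * cos u) - 2 * r \<le> D u"
        by (simp add: D_def power2_eq_square algebra_simps)
      also have "\<dots> = D u * 1" by simp
      also have "\<dots> \<le> D u * (D u / (1 - r)\<^sup>2)"
        using Dge[of u] sq by (intro mult_left_mono less_imp_le[OF Dpos]) (simp add: le_divide_eq)
      finally show ?thesis by (simp add: power2_eq_square)
    qed
    have "- 2 * r * cos u * D u - 4 * r\<^sup>2 * (sin u)\<^sup>2 = 2 * r * (- ((1 + r\<^sup>2) * cos u) - 2 * r)"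
      unfolding sin_squared_eq D_def by (simp add: power2_eq_square algebra_simps)
    also have "\<dots> \<le> 2 * r * ((D u)\<^sup>2 / (1 - r)\<^sup>2)"
      using r key by (intro mult_left_mono) auto
    also have "\<dots> = 2 * c * (D u)\<^sup>2" by (simp add: c_def)
    finally have "(- 2 * r * cos u * D u - 4 * r\<^sup>2 * (sin u)\<^sup>2) / (D u)\<^sup>2 \<le> 2 * c"
      using Dpos[of u] by (simp add: divide_le_eq)
    then show "(- 2 * r * cos u * D u - 4 * r\<^sup>2 * (sin u)\<^sup>2) / (D u)\<^sup>2 - 2 * c \<le> 0" by simp
  qed simp
  have "ln (D (a * x + (1 - a) * y)) - c * (a * x + (1 - a) * y)\<^sup>2 \<ge>
      a * (ln (D x) - c * x\<^sup>2) + (1 - a) * (ln (D y) - c * y\<^sup>2)"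
    using conc a unfolding concave_on_iff by (auto dest!: spec[of _ a])
  moreover have "a * x\<^sup>2 + (1 - a) * y\<^sup>2 - (a * x + (1 - a) * y)\<^sup>2 = a * (1 - a) * (x - y)\<^sup>2"
    by (simp add: power2_eq_square algebra_simps)
  then have "c * (a * x\<^sup>2 + (1 - a) * y\<^sup>2 - (a * x + (1 - a) * y)\<^sup>2) = c * (a * (1 - a) * (x - y)\<^sup>2)" by simp
  ultimately show ?thesis unfolding D_def[symmetric] c_def[symmetric] by (simp add: algebra_simps)
qed

text \<open>
  A matrix and its transpose have the same operator norm, and its square is the operator norm of
  \<open>A\<^sup>T A\<close>. With \<open>y = A\<^sup>T h\<close>, the Cauchy-Schwarz inequality bounds both \<open>\<parallel>y\<parallel>\<^sup>2 = \<langle>h, A y\<rangle>\<close> and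
  \<open>\<parallel>A y\<parallel>\<^sup>2 = \<langle>A\<^sup>T A y, y\<rangle>\<close>.
\<close>

lemma norm_transpose_mult_le:
  fixes A :: "real^'n^'m"
  shows "(norm (transpose A *v h))\<^sup>2 \<le> onorm (\<lambda>x. (transpose A ** A) *v x) * (norm h)\<^sup>2"
proof -
  define y where "y = transpose A *v h"
  define M where "M = onorm (\<lambda>x. (transpose A ** A) *v x)"
  have bl: "bounded_linear (\<lambda>x. (transpose A ** A) *v x)"
    by (rule matrix_vector_mul_bounded_linear)
  have "(norm (A *v y))\<^sup>2 = y \<bullet> ((transpose A ** A) *v y)"
    by (simp add: power2_norm_eq_inner dot_lmul_matrix inner_commute flip: matrix_vector_mul_assoc transpose_matrix_vector)
       (metis dot_lmul_matrix inner_commute transpose_matrix_vector)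
  also have "\<dots> \<le> norm y * (M * norm y)"
    by (rule order_trans[OF norm_cauchy_schwarz])
       (use onorm[OF bl, of y] in \<open>auto intro!: mult_left_mono simp: M_def\<close>)
  finally have 1: "(norm (A *v y))\<^sup>2 \<le> M * (norm y)\<^sup>2" by (simp add: power2_eq_square algebra_simps)
  have "(norm y)\<^sup>2 = h \<bullet> (A *v y)"
    unfolding power2_norm_eq_inner y_def by (simp add: dot_lmul_matrix inner_commute transpose_matrix_vector)
  also have "\<dots> \<le> norm h * norm (A *v y)" by (rule norm_cauchy_schwarz)
  finally have "((norm y)\<^sup>2)\<^sup>2 \<le> (norm h * norm (A *v y))\<^sup>2" by (intro power_mono) auto
  also have "\<dots> = (norm h)\<^sup>2 * (norm (A *v y))\<^sup>2" by (simp add: power_mult_distrib)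
  also have "\<dots> \<le> (norm h)\<^sup>2 * (M * (norm y)\<^sup>2)" by (intro mult_left_mono 1) auto
  finally have "(norm y)\<^sup>2 * (norm y)\<^sup>2 \<le> (M * (norm h)\<^sup>2) * (norm y)\<^sup>2"
    by (simp add: power2_eq_square algebra_simps)
  moreover have "0 \<le> M * (norm h)\<^sup>2" unfolding M_def by (intro mult_nonneg_nonneg onorm_pos_le[OF bl]) auto
  ultimately have "(norm y)\<^sup>2 \<le> M * (norm h)\<^sup>2"
    using mult_right_le_imp_le[of "(norm y)\<^sup>2" "(norm y)\<^sup>2" "M * (norm h)\<^sup>2"]
    by (cases "y = 0") simp_all
  then show ?thesis unfolding M_def y_def .
qed

lemma log_concave_exp:
  assumes "\<And>x y a. 0 \<le> a \<Longrightarrow> a \<le> 1 \<Longrightarrow> H (a *\<^sub>R x + (1 - a) *\<^sub>R y) \<ge> a * H x + (1 - a) * H y"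
  shows "log_concave (\<lambda>x. exp (H x))"
  unfolding log_concave_def using assms by (auto simp: powr_def exp_add[symmetric])

text \<open>
  Positivity of the limit makes \<open>powr\<close> continuous there even for the exponent 0.
\<close>

lemma log_concave_LIMSEQ:
  assumes G: "\<And>K::nat. K > 0 \<Longrightarrow> log_concave (G K)"
    and lim: "\<And>x. (\<lambda>K. G K x) \<longlonglongrightarrow> F x"
    and pos: "\<And>x. 0 < F x"
  shows "log_concave F"
  unfolding log_concave_def
proof (intro conjI allI impI)
  fix x y :: 'a and a :: real
  show "0 \<le> F x" using pos less_imp_le by blast
  assume a: "0 \<le> a \<and> a \<le> 1"
  have "(\<lambda>K. G K x powr a * G K y powr (1 - a)) \<longlonglongrightarrow> F x powr a * F y powr (1 - a)"
    using pos[of x] pos[of y] by (intro tendsto_intros lim) auto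
  then show "F x powr a * F y powr (1 - a) \<le> F (a *\<^sub>R x + (1 - a) *\<^sub>R y)"
    by (rule LIMSEQ_le[OF _ lim]) (use G a in \<open>auto simp: log_concave_def intro!: exI[of _ 1]\<close>)
qed

text \<open>
  The last term is the convexity defect of the squared norm, which has to absorb the defects of the
  cosine factors.
\<close>

lemma norm_convex_comb_sq:
  fixes x y :: "'a::real_inner"
  shows "(norm (a *\<^sub>R x + (1 - a) *\<^sub>R y))\<^sup>2 =
    a * (norm x)\<^sup>2 + (1 - a) * (norm y)\<^sup>2 - a * (1 - a) * (norm (x - y))\<^sup>2"
  by (simp add: power2_norm_eq_inner inner_simps inner_commute[of y x] algebra_simps)

lemma phase_eq: "phase A b j t = b $ j + (transpose A *v t) $ j"
  by (simp add: phase_def matrix_vector_mult_def transpose_def)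

lemma phase_convex_comb:
  "phase A b j (a *\<^sub>R x + (1 - a) *\<^sub>R y) = a * phase A b j x + (1 - a) * phase A b j y"
  by (simp add: phase_eq matrix_vector_right_distrib matrix_vector_mult_scaleR algebra_simps)

lemma summable_curvature:
  assumes q: "0 < q" "q < (1::real)"
  shows "summable (\<lambda>k. q ^ (2 * Suc k - 1) / (1 - q ^ (2 * Suc k - 1))\<^sup>2)"
proof (rule summable_comparison_test'[of "\<lambda>k. q ^ k / (1 - q)\<^sup>2" 0])
  show "summable (\<lambda>k. q ^ k / (1 - q)\<^sup>2)" using q by (intro summable_divide summable_geometric) auto
  fix k
  have "q ^ (2 * Suc k - 1) \<le> q ^ k" using q by (intro power_decreasing) auto
  moreover have "q ^ (2 * Suc k - 1) \<le> q ^ 1" using q by (intro power_decreasing) auto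
  ultimately show "norm (q ^ (2 * Suc k - 1) / (1 - q ^ (2 * Suc k - 1))\<^sup>2) \<le> q ^ k / (1 - q)\<^sup>2"
    using q by (auto intro!: frac_le power_mono)
qed

text \<open>
  Along a segment from \<open>x\<close> to \<open>y\<close> the factors lose at most \<open>\<alpha> (1 - \<alpha>) S \<parallel>A\<^sup>T (x - y)\<parallel>\<^sup>2\<close> in the logarithm,
  where \<open>S\<close> is a partial sum of the series in the hypothesis, while the Gaussian gains
  \<open>\<alpha> (1 - \<alpha>) \<parallel>x - y\<parallel>\<^sup>2 / 2\<close>. The hypothesis says that the gain is at least the loss.
\<close>

lemma G_fun_log_concave:
  fixes A :: "real^'n^'m"
  assumes s: "s > 0" and q: "q = exp (- s)"
    and small: "onorm (\<lambda>x. (transpose A ** A) *v x) *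
        (\<Sum>k. q ^ (2 * Suc k - 1) / (1 - q ^ (2 * Suc k - 1))\<^sup>2) \<le> 1/2"
  shows "log_concave (G_fun A b s K)"
proof -
  have q01: "0 < q" "q < 1" using s by (auto simp: q)
  define c where "c k = q ^ (2 * Suc k - 1) / (1 - q ^ (2 * Suc k - 1))\<^sup>2" for k
  define L where "L k u = ln (theta_factor q (Suc k) u)" for k u
  define H where "H t = - (norm t)\<^sup>2 / 2 + (\<Sum>j\<in>UNIV. \<Sum>k<K. L k (phase A b j t))" for t
  have G: "G_fun A b s K t = exp (H t)" for t
  proof -
    have "exp (\<Sum>j\<in>UNIV. \<Sum>k<K. L k (phase A b j t)) =
        (\<Prod>j\<in>UNIV. \<Prod>k<K. theta_factor q (Suc k) (phase A b j t))"
      by (simp add: exp_sum L_def theta_factor_pos[OF q01])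
    then show ?thesis
      by (simp only: H_def exp_add G_fun_def One_nat_def prod.atLeast1_atMost_eq q)
  qed
  have Lc: "L k (a * u + (1 - a) * v) \<ge> a * L k u + (1 - a) * L k v - c k * (a * (1 - a) * (u - v)\<^sup>2)"
    if "0 \<le> a" "a \<le> 1" for k a u v
    using theta_log_concave_defect[of "q ^ (2 * k + 1)" a u v] that q01 power_less_one_iff[of q "2 * k + 1"]
    by (simp add: L_def theta_factor_Suc c_def)
  define S where "S = (\<Sum>k<K. c k)"
  have c0: "0 \<le> c k" for k using q01 by (simp add: c_def)
  have "S \<le> suminf c"
    unfolding S_def using summable_curvature[OF q01] c0 by (intro sum_le_suminf) (auto simp: c_def[abs_def])
  then have "onorm (\<lambda>x. (transpose A ** A) *v x) * S \<le> onorm (\<lambda>x. (transpose A ** A) *v x) * suminf c"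
    by (intro mult_left_mono onorm_pos_le matrix_vector_mul_bounded_linear)
  also have "\<dots> \<le> 1/2" using small unfolding c_def[abs_def] .
  finally have MS: "onorm (\<lambda>x. (transpose A ** A) *v x) * S \<le> 1/2" .
  have S0: "0 \<le> S" unfolding S_def by (intro sum_nonneg c0)
  have "log_concave (\<lambda>t. exp (H t))"
  proof (rule log_concave_exp)
    fix x y :: "real^'m" and a :: real
    assume a: "0 \<le> a" "a \<le> 1"
    define h where "h = x - y"
    define p where "p j = phase A b j x - phase A b j y" for j
    have p: "(\<Sum>j\<in>UNIV. (p j)\<^sup>2) = (norm (transpose A *v h))\<^sup>2"
      unfolding power2_norm_eq_inner inner_vec_def
      by (simp add: p_def phase_eq h_def matrix_vector_mult_diff_distrib power2_eq_square)
    have "S * (\<Sum>j\<in>UNIV. (p j)\<^sup>2) \<le> S * (onorm (\<lambda>x. (transpose A ** A) *v x) * (norm h)\<^sup>2)"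
      unfolding p by (intro mult_left_mono norm_transpose_mult_le S0)
    also have "\<dots> \<le> 1/2 * (norm h)\<^sup>2"
      using mult_right_mono[OF MS, of "(norm h)\<^sup>2"] by (simp add: algebra_simps)
    finally have "a * (1 - a) * (S * (\<Sum>j\<in>UNIV. (p j)\<^sup>2)) \<le> a * (1 - a) * (1/2 * (norm h)\<^sup>2)"
      using a by (intro mult_left_mono) auto
    moreover have "(\<Sum>j\<in>UNIV. \<Sum>k<K. L k (phase A b j (a *\<^sub>R x + (1 - a) *\<^sub>R y))) \<ge>
        (\<Sum>j\<in>UNIV. \<Sum>k<K. a * L k (phase A b j x) + (1 - a) * L k (phase A b j y) - c k * (a * (1 - a) * (p j)\<^sup>2))"
      unfolding phase_convex_comb p_def by (intro sum_mono Lc a)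
    moreover have "(\<Sum>j\<in>UNIV. \<Sum>k<K. a * L k (phase A b j x) + (1 - a) * L k (phase A b j y) - c k * (a * (1 - a) * (p j)\<^sup>2))
      = a * (\<Sum>j\<in>UNIV. \<Sum>k<K. L k (phase A b j x)) + (1 - a) * (\<Sum>j\<in>UNIV. \<Sum>k<K. L k (phase A b j y))
        - a * (1 - a) * (S * (\<Sum>j\<in>UNIV. (p j)\<^sup>2))"
      by (simp add: sum.distrib sum_subtractf sum_distrib_left sum_distrib_right S_def sum_product mult_ac)
    ultimately show "H (a *\<^sub>R x + (1 - a) *\<^sub>R y) \<ge> a * H x + (1 - a) * H y"
      unfolding H_def norm_convex_comb_sq h_def[symmetric] by (simp add: field_simps)
  qed
  then show ?thesis by (simp add: G[abs_def])
qed

section \<open>The Gaussian integral as a theta series\<close>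

lemma G_fun_tendsto:
  assumes s: "s > 0"
  shows "(\<lambda>K. G_fun A b s K t) \<longlonglongrightarrow> F_fun A b s t * exp (- (norm t)\<^sup>2 / 2)"
proof -
  have q01: "0 < exp (- s)" "exp (- s) < 1" using s by auto
  have "(\<lambda>K. G_fun A b s K t) \<longlonglongrightarrow> exp (- (norm t)\<^sup>2 / 2) * F_fun A b s t"
    unfolding G_fun_def F_fun_def by (intro tendsto_intros theta_prod_tendsto[OF q01])
  then show ?thesis by (simp only: mult.commute)
qed

lemma F_fun_pos:
  assumes s: "s > 0"
  shows "0 < F_fun A b s t"
  unfolding F_fun_def using s by (intro prod_pos theta_prodinf_pos) auto

lemma G_fun_nonneg:
  assumes s: "s > 0"
  shows "0 \<le> G_fun A b s K t"
  unfolding G_fun_def One_nat_def prod.atLeast1_atMost_eq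
  using s by (intro mult_nonneg_nonneg prod_nonneg less_imp_le[OF theta_factor_pos]) auto

lemma borel_measurable_G_fun: "G_fun A b s K \<in> borel_measurable borel"
  unfolding G_fun_def[abs_def] theta_factor_def[abs_def] phase_def[abs_def]
  by (intro borel_measurable_continuous_onI continuous_intros) auto

lemma integrable_gaussian:
  "integrable lborel (\<lambda>t::'a::euclidean_space. exp (- (norm t)\<^sup>2 / 2))"
  using integrable_norm[OF integrable_gaussian_fourier[of "0::'a"]] by (simp add: norm_mult)

lemma G_fun_bound:
  fixes A :: "real^'n^'m"
  assumes s: "s > 0"
  shows "G_fun A b s K t \<le>
    (\<Prod>k. theta_factor (exp (- s)) (Suc k) 0) ^ CARD('n) * exp (- (norm t)\<^sup>2 / 2)"
proof -
  have q01: "0 < exp (- s)" "exp (- s) < 1" using s by auto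
  have "(\<Prod>j\<in>UNIV. \<Prod>k=1..K. theta_factor (exp (- s)) k (phase A b j t))
     \<le> (\<Prod>j\<in>(UNIV::'n set). \<Prod>k. theta_factor (exp (- s)) (Suc k) 0)"
    using theta_prod_bound[OF q01] theta_factor_pos[OF q01]
    by (intro prod_mono) (auto simp: prod.atLeast1_atMost_eq less_imp_le intro!: prod_nonneg)
  then show ?thesis unfolding G_fun_def by (simp add: mult.commute)
qed

lemma
  fixes A :: "real^'n^'m"
  assumes s: "s > 0"
  shows integrable_F_fun: "integrable lborel (\<lambda>t. F_fun A b s t * exp (- (norm t)\<^sup>2 / 2))"
    and integral_G_fun_tendsto: "(\<lambda>K. LINT t|lborel. G_fun A b s K t) \<longlonglongrightarrow>
      (LINT t|lborel. F_fun A b s t * exp (- (norm t)\<^sup>2 / 2))"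
proof -
  let ?w = "\<lambda>t. (\<Prod>k. theta_factor (exp (- s)) (Suc k) 0) ^ CARD('n) * exp (- (norm t)\<^sup>2 / 2)"
  have meas: "G_fun A b s K \<in> borel_measurable lborel" for K
    using borel_measurable_G_fun by simp
  have measF: "(\<lambda>t. F_fun A b s t * exp (- (norm t)\<^sup>2 / 2)) \<in> borel_measurable lborel"
    by (rule borel_measurable_LIMSEQ_real[OF G_fun_tendsto[OF s] meas])
  have w: "integrable lborel ?w"
    by (intro integrable_mult_right integrable_gaussian)
  have bd: "AE t in lborel. norm (G_fun A b s K t) \<le> ?w t" for K
    using G_fun_bound[OF s, of A b K] G_fun_nonneg[OF s, of A b K] by (intro AE_I2) simp
  have lim: "AE t in lborel. (\<lambda>K. G_fun A b s K t) \<longlonglongrightarrow> F_fun A b s t * exp (- (norm t)\<^sup>2 / 2)"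
    by (intro AE_I2 G_fun_tendsto[OF s])
  show "integrable lborel (\<lambda>t. F_fun A b s t * exp (- (norm t)\<^sup>2 / 2))"
    by (rule integrable_dominated_convergence[OF measF meas w lim bd])
  show "(\<lambda>K. LINT t|lborel. G_fun A b s K t) \<longlonglongrightarrow>
      (LINT t|lborel. F_fun A b s t * exp (- (norm t)\<^sup>2 / 2))"
    by (rule integral_dominated_convergence[OF measF meas w lim bd])
qed

text \<open>
  Expanding a product of sums produces a sum over functions into the integers; this map identifies
  them with the points of the lattice.
\<close>

definition lattice_point :: "('n \<Rightarrow> int) \<Rightarrow> real^'n" where
  "lattice_point x = (\<chi> j. of_int (x j))"

lemma bij_betw_lattice_point: "bij_betw lattice_point UNIV (integer_lattice :: (real^'n) set)"
proof (rule bij_betwI[where g = "\<lambda>v j. \<lfloor>v $ j\<rfloor>"])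
  show "lattice_point (\<lambda>j. \<lfloor>v $ j\<rfloor>) = v" if "v \<in> integer_lattice" for v :: "real^'n"
    using that by (auto simp: lattice_point_def integer_lattice_def vec_eq_iff elim!: Ints_cases)
qed (auto simp: lattice_point_def integer_lattice_def)

definition lattice_term :: "real^'n^'m \<Rightarrow> real^'n \<Rightarrow> real \<Rightarrow> real^'n \<Rightarrow> complex" where
  "lattice_term A b s x = exp (- complex_of_real ((B_mat A s *v x) \<bullet> x) + \<i> * complex_of_real (b \<bullet> x))"

lemma B_mat_quadratic_form:
  "(B_mat A s *v x) \<bullet> x = s * (norm x)\<^sup>2 + (norm (A *v x))\<^sup>2 / 2"
proof -
  have "((transpose A ** A) *v x) \<bullet> x = (norm (A *v x))\<^sup>2"
    by (simp add: power2_norm_eq_inner matrix_vector_mul_assoc[symmetric] transpose_matrix_vector dot_lmul_matrix)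
  then show ?thesis
    by (simp add: B_mat_def matrix_vector_mult_add_rdistrib scaleR_matrix_vector_assoc[symmetric]
        inner_simps power2_norm_eq_inner)
qed

lemma positive_definite_B_mat:
  assumes s: "s > 0"
  shows "positive_definite (B_mat A s)"
  unfolding positive_definite_def
proof (intro conjI allI impI)
  show "transpose (B_mat A s) = B_mat A s"
    by (simp add: B_mat_def transpose_def vec_eq_iff mat_def matrix_matrix_mult_def mult.commute)
  fix x :: "real^'a" assume "x \<noteq> 0"
  then show "(B_mat A s *v x) \<bullet> x > 0"
    unfolding B_mat_quadratic_form using s by (intro add_pos_nonneg) auto
qed

lemma norm_lattice_point_sq: "(norm (lattice_point x))\<^sup>2 = (\<Sum>j\<in>UNIV. (of_int (x j))\<^sup>2)"
  unfolding power2_norm_eq_inner inner_vec_def by (simp add: lattice_point_def power2_eq_square)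

lemma norm_lattice_term_le:
  "norm (lattice_term A b s (lattice_point x)) \<le> (\<Prod>j\<in>UNIV. exp (- s * (of_int (x j))\<^sup>2))"
  by (simp add: lattice_term_def B_mat_quadratic_form norm_lattice_point_sq exp_sum[symmetric]
      sum_distrib_left sum_negf)

text \<open>
  Each factor of the truncated product is expanded by \<open>finite_jacobi_triple_product\<close>. Multiplying out
  over \<open>j\<close> gives a finite combination of the characters \<open>cis (\<langle>A x, t\<rangle>)\<close>, and the Gaussian integral turns
  each of them into \<open>exp (- \<parallel>A x\<parallel>\<^sup>2 / 2)\<close>, which together with the weight \<open>q\<^bsup>\<parallel>x\<parallel>\<^sup>2\<^esup>\<close> makes up
  \<open>exp (- \<langle>B x, x\<rangle>)\<close>.
\<close>

lemma integral_G_fun: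
  fixes A :: "real^'n^'m"
  assumes s: "s > 0" and q: "q = exp (- s)"
  shows "complex_of_real ((2 * pi) powr (- real CARD('m) / 2) * (LINT t|lborel. G_fun A b s K t)) =
    (\<Sum>\<^sub>\<infinity>x\<in>UNIV. of_real (\<Prod>j\<in>UNIV. jacobi_coeff q K (x j)) * lattice_term A b s (lattice_point x))"
proof -
  have q01: "0 < q" "q < 1" using s by (auto simp: q)
  define X where "X = PiE (UNIV :: 'n set) (\<lambda>_. {- int K..int K})"
  have finX: "finite X" unfolding X_def by (intro finite_PiE) auto
  define C where "C x = (\<Prod>j\<in>UNIV. jacobi_coeff q K (x j))" for x :: "'n \<Rightarrow> int"
  define Q where "Q x = exp (- s * (norm (lattice_point x))\<^sup>2)" for x :: "'n \<Rightarrow> int"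
  have qp: "q powi k\<^sup>2 = exp (- s * (of_int k)\<^sup>2)" for k :: int
    unfolding q exp_power_int by (simp add: mult.commute)
  have freq: "(\<Sum>j\<in>UNIV. of_int (x j) * phase A b j t) =
      b \<bullet> lattice_point x + (A *v lattice_point x) \<bullet> t" for x t
  proof -
    have "(A *v lattice_point x) \<bullet> t = lattice_point x \<bullet> (transpose A *v t)"
      by (metis dot_lmul_matrix inner_commute transpose_matrix_vector)
    then show ?thesis
      by (simp add: phase_eq inner_vec_def lattice_point_def algebra_simps sum.distrib)
  qed
  have expand: "complex_of_real (G_fun A b s K t) =
      (\<Sum>x\<in>X. of_real (C x * Q x) * cis (b \<bullet> lattice_point x) *
         (cis ((A *v lattice_point x) \<bullet> t) * of_real (exp (- (norm t)\<^sup>2 / 2))))" for t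
  proof -
    have "complex_of_real (\<Prod>j\<in>UNIV. \<Prod>k=1..K. theta_factor q k (phase A b j t)) =
      (\<Prod>j\<in>UNIV. \<Sum>k\<in>{- int K..int K}. of_real (jacobi_coeff q K k * q powi k\<^sup>2) * cis (of_int k * phase A b j t))"
      unfolding of_real_prod[of _ UNIV] finite_jacobi_triple_product[OF q01] ..
    also have "\<dots> = (\<Sum>x\<in>X. \<Prod>j\<in>UNIV. of_real (jacobi_coeff q K (x j) * q powi (x j)\<^sup>2) * cis (of_int (x j) * phase A b j t))"
      unfolding X_def by (rule prod_sum_PiE) auto
    also have "\<dots> = (\<Sum>x\<in>X. of_real (C x * Q x) * cis (b \<bullet> lattice_point x + (A *v lattice_point x) \<bullet> t))"
    proof (rule sum.cong[OF refl])
      fix x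
      have "(\<Prod>j\<in>UNIV. cis (of_int (x j) * phase A b j t)) = cis (b \<bullet> lattice_point x + (A *v lattice_point x) \<bullet> t)"
        unfolding freq[symmetric] by (simp add: cis_conv_exp exp_sum sum_distrib_left)
      moreover have "(\<Prod>j\<in>UNIV. q powi (x j)\<^sup>2) = Q x"
        unfolding Q_def norm_lattice_point_sq qp by (simp add: exp_sum sum_distrib_left flip: sum_negf)
      ultimately show "(\<Prod>j\<in>UNIV. of_real (jacobi_coeff q K (x j) * q powi (x j)\<^sup>2) * cis (of_int (x j) * phase A b j t))
        = of_real (C x * Q x) * cis (b \<bullet> lattice_point x + (A *v lattice_point x) \<bullet> t)"
        by (simp only: prod.distrib C_def of_real_mult of_real_prod[symmetric])
    qed
    finally have "complex_of_real (G_fun A b s K t) = of_real (exp (- (norm t)\<^sup>2 / 2)) *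
      (\<Sum>x\<in>X. of_real (C x * Q x) * cis (b \<bullet> lattice_point x + (A *v lattice_point x) \<bullet> t))"
      unfolding G_fun_def of_real_mult q by simp
    then show ?thesis
      unfolding cis_mult[symmetric] sum_distrib_left by (simp only: mult_ac)
  qed
  have lt: "of_real (Q x) * cis (b \<bullet> lattice_point x) * of_real (exp (- (norm (A *v lattice_point x))\<^sup>2 / 2))
     = lattice_term A b s (lattice_point x)" for x
    unfolding lattice_term_def B_mat_quadratic_form Q_def cis_conv_exp exp_of_real[symmetric] mult_exp_exp
    by (rule arg_cong[of _ _ exp]) (simp add: field_simps)
  have "complex_of_real (LINT t|lborel. G_fun A b s K t) = (LINT t|lborel. complex_of_real (G_fun A b s K t))"
    by simp
  also have "\<dots> = (\<Sum>x\<in>X. of_real (C x * Q x) * cis (b \<bullet> lattice_point x) *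
      of_real ((2 * pi) powr (real CARD('m) / 2) * exp (- (norm (A *v lattice_point x))\<^sup>2 / 2)))"
    unfolding expand
    by (simp only: Bochner_Integration.integral_sum[OF integrable_mult_right[OF integrable_gaussian_fourier]]
        integral_mult_right_zero integral_gaussian_fourier DIM_cart DIM_real mult_1_right)
  also have "\<dots> = of_real ((2 * pi) powr (real CARD('m) / 2)) *
      (\<Sum>x\<in>X. of_real (C x) * lattice_term A b s (lattice_point x))"
    unfolding lt[symmetric] of_real_mult sum_distrib_left by (simp only: mult_ac)
  finally have "complex_of_real (LINT t|lborel. G_fun A b s K t) = \<dots>" .
  moreover have "(2 * pi) powr (- real CARD('m) / 2) * (2 * pi) powr (real CARD('m) / 2) = 1"
    by (simp flip: powr_add)
  then have "complex_of_real ((2 * pi) powr (- real CARD('m) / 2)) * of_real ((2 * pi) powr (real CARD('m) / 2)) = 1"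
    by (simp only: of_real_mult[symmetric] of_real_1)
  ultimately have "complex_of_real ((2 * pi) powr (- real CARD('m) / 2) * (LINT t|lborel. G_fun A b s K t)) =
      (\<Sum>x\<in>X. of_real (C x) * lattice_term A b s (lattice_point x))"
    by (simp only: of_real_mult mult.assoc[symmetric] mult_1_left)
  also have "\<dots> = (\<Sum>\<^sub>\<infinity>x\<in>UNIV. of_real (C x) * lattice_term A b s (lattice_point x))"
  proof -
    \<comment> \<open>The coefficients vanish outside the box, so the finite sum already runs over the whole lattice.\<close>
    have "C x = 0" if "x \<notin> X" for x
    proof -
      obtain j where "x j \<notin> {- int K..int K}" using \<open>x \<notin> X\<close> unfolding X_def by blast
      then have "\<bar>x j\<bar> > int K" by auto
      then have "jacobi_coeff q K (x j) = 0" by (rule jacobi_coeff_zero)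
      then show ?thesis unfolding C_def by (intro prod_zero) auto
    qed
    then show ?thesis
      by (subst infsum_finite[OF finX, symmetric], intro infsum_cong_neutral) auto
  qed
  finally show ?thesis unfolding C_def .
qed

lemma summable_lattice_term:
  assumes s: "s > 0"
  shows "lattice_term A b s summable_on integer_lattice"
proof -
  have "(\<lambda>x. lattice_term A b s (lattice_point x)) summable_on UNIV"
    by (rule abs_summable_summable,
        rule Infinite_Sum.abs_summable_on_comparison_test'[OF summable_gaussian_int_fun[OF s] norm_lattice_term_le])
  then show ?thesis
    using summable_on_reindex_bij_betw[OF bij_betw_lattice_point] by blast
qed

text \<open>
  Every coefficient tends to \<open>1 / qpoch_inf q\<close>, and there is one coefficient for each of the \<open>n\<close>
  coordinates. Letting the truncation go to infinity on both sides of \<open>integral_G_fun\<close>, by dominated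
  convergence for the integral on one side and for the lattice sum on the other, therefore
  produces the factor \<open>qpoch_inf q ^ n\<close>.
\<close>

lemma gaussian_theta_identity:
  fixes A :: "real^'n^'m"
  assumes s: "s > 0" and q: "q = exp (- s)"
  shows "complex_of_real ((2 * pi) powr (- real CARD('m) / 2) * qpoch_inf q ^ CARD('n) *
      (LINT t|lborel. F_fun A b s t * exp (- (norm t)\<^sup>2 / 2))) =
    (\<Sum>\<^sub>\<infinity>x\<in>integer_lattice. lattice_term A b s x)"
proof -
  have q01: "0 < q" "q < 1" using s by (auto simp: q)
  define n where "n = CARD('n)"
  define M where "M = ((1 / qpoch_inf q)\<^sup>2) ^ n"
  define T where "T K x = complex_of_real (\<Prod>j\<in>UNIV. jacobi_coeff q K (x j)) * lattice_term A b s (lattice_point x)"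
    for K and x :: "'n \<Rightarrow> int"
  have "(\<lambda>K. infsum (T K) UNIV) \<longlonglongrightarrow>
      (\<Sum>\<^sub>\<infinity>x\<in>UNIV. of_real ((1 / qpoch_inf q) ^ n) * lattice_term A b s (lattice_point x))"
  proof (rule tannery_infsum)
    show "(\<lambda>x::'n \<Rightarrow> int. M * (\<Prod>j\<in>UNIV. exp (- s * (of_int (x j))\<^sup>2))) summable_on UNIV"
      by (intro summable_on_cmult_right summable_gaussian_int_fun[OF s])
    fix K and x :: "'n \<Rightarrow> int"
    have "0 \<le> (\<Prod>j\<in>UNIV. jacobi_coeff q K (x j))"
      by (intro prod_nonneg jacobi_coeff_bounds[OF q01])
    moreover have "(\<Prod>j\<in>UNIV. jacobi_coeff q K (x j)) \<le> (\<Prod>j\<in>(UNIV::'n set). (1 / qpoch_inf q)\<^sup>2)"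
      by (intro prod_mono conjI jacobi_coeff_bounds[OF q01])
    ultimately have "norm (complex_of_real (\<Prod>j\<in>UNIV. jacobi_coeff q K (x j))) \<le> M"
      by (simp add: M_def n_def del: of_real_prod)
    then show "norm (T K x) \<le> M * (\<Prod>j\<in>UNIV. exp (- s * (of_int (x j))\<^sup>2))"
      unfolding T_def norm_mult by (intro mult_mono norm_lattice_term_le) (auto simp: M_def)
  next
    fix x :: "'n \<Rightarrow> int"
    have "(\<lambda>K. \<Prod>j\<in>UNIV. jacobi_coeff q K (x j)) \<longlonglongrightarrow> (\<Prod>j\<in>(UNIV::'n set). 1 / qpoch_inf q)"
      by (intro tendsto_prod jacobi_coeff_tendsto[OF q01])
    then have "(\<lambda>K. \<Prod>j\<in>UNIV. jacobi_coeff q K (x j)) \<longlonglongrightarrow> (1 / qpoch_inf q) ^ n"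
      by (simp add: n_def)
    then show "(\<lambda>K. T K x) \<longlonglongrightarrow> of_real ((1 / qpoch_inf q) ^ n) * lattice_term A b s (lattice_point x)"
      unfolding T_def by (intro tendsto_mult tendsto_of_real tendsto_const)
  qed
  moreover have "(\<lambda>K. infsum (T K) UNIV) \<longlonglongrightarrow> complex_of_real ((2 * pi) powr (- real CARD('m) / 2) *
      (LINT t|lborel. F_fun A b s t * exp (- (norm t)\<^sup>2 / 2)))"
    unfolding T_def integral_G_fun[OF s q, symmetric]
    by (intro tendsto_of_real tendsto_mult tendsto_const integral_G_fun_tendsto[OF s])
  ultimately have "complex_of_real ((2 * pi) powr (- real CARD('m) / 2) *
      (LINT t|lborel. F_fun A b s t * exp (- (norm t)\<^sup>2 / 2))) =
      (\<Sum>\<^sub>\<infinity>x\<in>UNIV. of_real ((1 / qpoch_inf q) ^ n) * lattice_term A b s (lattice_point x))"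
    using LIMSEQ_unique by blast
  also have "\<dots> = of_real ((1 / qpoch_inf q) ^ n) * (\<Sum>\<^sub>\<infinity>x\<in>UNIV. lattice_term A b s (lattice_point x))"
    by (rule infsum_cmult_right')
  also have "(\<Sum>\<^sub>\<infinity>x\<in>UNIV. lattice_term A b s (lattice_point x)) = (\<Sum>\<^sub>\<infinity>x\<in>integer_lattice. lattice_term A b s x)"
    by (rule infsum_reindex_bij_betw[OF bij_betw_lattice_point])
  finally have "complex_of_real (qpoch_inf q ^ n) * complex_of_real ((2 * pi) powr (- real CARD('m) / 2) *
      (LINT t|lborel. F_fun A b s t * exp (- (norm t)\<^sup>2 / 2))) =
      complex_of_real (qpoch_inf q ^ n * (1 / qpoch_inf q) ^ n) * (\<Sum>\<^sub>\<infinity>x\<in>integer_lattice. lattice_term A b s x)"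
    by (simp only: of_real_mult mult.assoc)
  moreover have "qpoch_inf q ^ n * (1 / qpoch_inf q) ^ n = 1"
    using qpoch_inf_pos[OF q01] by (simp flip: power_mult_distrib)
  ultimately have "complex_of_real (qpoch_inf q ^ n) * complex_of_real ((2 * pi) powr (- real CARD('m) / 2) *
      (LINT t|lborel. F_fun A b s t * exp (- (norm t)\<^sup>2 / 2))) =
      (\<Sum>\<^sub>\<infinity>x\<in>integer_lattice. lattice_term A b s x)"
    by (simp only: of_real_1 mult_1_left)
  then show ?thesis unfolding n_def by (simp only: of_real_mult mult_ac)
qed

theorem theorem3p1:
  fixes A :: "real^'n^'m" and b :: "real^'n" and s q :: real and B :: "real^'n^'n"
  assumes s: "s > 0"
    and q: "q = exp (- s)"
    and B: "B = B_mat A s"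
  shows
    "positive_definite B \<and>
     (\<forall>j t. convergent_prod (\<lambda>k. theta_factor q (Suc k) (phase A b j t))) \<and>
     (\<forall>t. 0 \<le> F_fun A b s t) \<and>
     (convergent_prod (\<lambda>k. (1 - q ^ (2 * Suc k)) ^ CARD('n)) \<and>
      integrable lborel (\<lambda>t. F_fun A b s t * exp (- (norm t)\<^sup>2 / 2)) \<and>
      (\<lambda>x. exp (- complex_of_real ((B *v x) \<bullet> x) + \<i> * complex_of_real (b \<bullet> x)))
        summable_on integer_lattice \<and>
      complex_of_real
        ((2 * pi) powr (- real CARD('m) / 2) *
         (\<Prod>k. (1 - q ^ (2 * Suc k)) ^ CARD('n)) *
         (LINT t|lborel. F_fun A b s t * exp (- (norm t)\<^sup>2 / 2)))
      = (\<Sum>\<^sub>\<infinity>x\<in>integer_lattice.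
           exp (- complex_of_real ((B *v x) \<bullet> x) + \<i> * complex_of_real (b \<bullet> x)))) \<and>
     (onorm (\<lambda>x. (transpose A ** A) *v x) *
        (\<Sum>k. q ^ (2 * Suc k - 1) / (1 - q ^ (2 * Suc k - 1))\<^sup>2) \<le> 1/2 \<longrightarrow>
      (\<forall>K>0. log_concave (G_fun A b s K)) \<and>
      log_concave (\<lambda>t. F_fun A b s t * exp (- (norm t)\<^sup>2 / 2)))"
proof (intro conjI allI impI)
  have q01: "0 < q" "q < 1" using s by (auto simp: q)
  have euler: "(\<Prod>k. (1 - q ^ (2 * Suc k)) ^ CARD('n)) = qpoch_inf q ^ CARD('n)"
    unfolding qpoch_inf_def by (rule prodinf_power[OF convergent_prod_qpoch[OF q01]])
  show "positive_definite B"
    unfolding B by (rule positive_definite_B_mat[OF s])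
  show "convergent_prod (\<lambda>k. theta_factor q (Suc k) (phase A b j t))" for j t
    by (rule convergent_prod_theta_factor[OF q01])
  show "0 \<le> F_fun A b s t" for t
    by (rule less_imp_le[OF F_fun_pos[OF s]])
  show "convergent_prod (\<lambda>k. (1 - q ^ (2 * Suc k)) ^ CARD('n))"
    by (rule convergent_prod_power[OF convergent_prod_qpoch[OF q01]])
  show "integrable lborel (\<lambda>t. F_fun A b s t * exp (- (norm t)\<^sup>2 / 2))"
    by (rule integrable_F_fun[OF s])
  show "(\<lambda>x. exp (- complex_of_real ((B *v x) \<bullet> x) + \<i> * complex_of_real (b \<bullet> x)))
        summable_on integer_lattice"
    using summable_lattice_term[OF s, of A b] by (simp add: lattice_term_def[abs_def] B)
  show "complex_of_real
        ((2 * pi) powr (- real CARD('m) / 2) *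
         (\<Prod>k. (1 - q ^ (2 * Suc k)) ^ CARD('n)) *
         (LINT t|lborel. F_fun A b s t * exp (- (norm t)\<^sup>2 / 2)))
      = (\<Sum>\<^sub>\<infinity>x\<in>integer_lattice.
           exp (- complex_of_real ((B *v x) \<bullet> x) + \<i> * complex_of_real (b \<bullet> x)))"
    unfolding euler gaussian_theta_identity[OF s q] by (simp add: lattice_term_def[abs_def] B)
next
  assume small: "onorm (\<lambda>x. (transpose A ** A) *v x) *
        (\<Sum>k. q ^ (2 * Suc k - 1) / (1 - q ^ (2 * Suc k - 1))\<^sup>2) \<le> 1/2"
  note lc = G_fun_log_concave[OF s q small]
  show "log_concave (G_fun A b s K)" for K by (rule lc)
  show "log_concave (\<lambda>t. F_fun A b s t * exp (- (norm t)\<^sup>2 / 2))"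
    by (rule log_concave_LIMSEQ[OF lc G_fun_tendsto[OF s]]) (simp add: F_fun_pos[OF s])
qed

end
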